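(* Let $n\ge2$, let $d_i$ be a metric on a nontrivial real vector space $X_i$, and let $f_i(u):=d_i(u,0_{X_i})$ for $u\in X_i$ $(i=1,\ldots,n)$. Suppose that there exist distinct indices $i,j\in\{1,\ldots,n\}$ such that $f_i$ is positively homogeneous, $f_j$ is absolutely homogeneous, and $f_k$ is $2$-homogeneous for all $k\ne i,j$. The following assertions hold: (i) Let $p\in(1,2]$ and $q\in\mathbb{R}$ with $\frac1p+\frac1q=1$. If $f_1,\ldots,f_n$ satisfy the $(p,q)$-Clarkson inequality, then $C_{\mathrm{NJ}}^{(\sigma)}(d_{\psi_p})=2^{\frac{\sigma}{p}-\sigma+1}$ for all $\sigma\in[p,q]$. (ii) Let $p\in(2,\infty)$ and $q\in\mathbb{R}$ with $\frac1p+\frac1q=1$. If $f_1,\ldots,f_n$ satisfy the $(q,p)$-Clarkson inequality, then $C_{\mathrm{NJ}}^{(\sigma)}(d_{\psi_p})=2^{1-\frac{\sigma}{p}}$ for all $\sigma\in[q,p]$. (iii) If $f_1,\ldots,f_n$ are subadditive and even, then $C_{\mathrm{NJ}}^{(\sigma)}(d_{\psi_1})=C_{\mathrm{NJ}}^{(\sigma)}(d_{\psi_\infty})=2$ for all $\sigma\in[1,\infty)$.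
   Context: For $p\in[1,\infty]$, $d_{\psi_p}$ is the metric on $\mathrm{P}:=X_1\times\cdots\times X_n$ given, for $x=(x_1,\ldots,x_n)$, $y=(y_1,\ldots,y_n)$, by $d_{\psi_p}(x,y)=\left(\sum_{i=1}^nd_i(x_i,y_i)^p\right)^{1/p}$ if $p<\infty$ and $d_{\psi_\infty}(x,y)=\max_{1\le i\le n}d_i(x_i,y_i)$. For a metric $d$ on a real vector space $X$ with $f(x):=d(x,0_X)$ and $f^\sigma(x):=(f(x))^\sigma$, the von Neumann-Jordan constant of order $\sigma\in[1,\infty)$ is $$C_{\mathrm{NJ}}^{(\sigma)}(d):=\sup_{(x,y)\ne(0_X,0_X)}\frac{f^\sigma(x+y)+f^\sigma(x-y)}{2^{\sigma-1}(f^\sigma(x)+f^\sigma(y))}\in(0,\infty].$$ For $\alpha\in(1,2]$ and $\beta\in\mathbb{R}$ with $\frac1\alpha+\frac1\beta=1$, $d$ (equivalently, $f$) satisfies the $(\alpha,\beta)$-Clarkson inequality if $f^\beta(x+y)+f^\beta(x-y)\le2\left(f^\alpha(x)+f^\alpha(y)\right)^{\beta/\alpha}$ for all $x,y\in X$. A function $f$ on $X$ is: positively homogeneous if $f(\lambda x)=\lambda f(x)$ for all $x\in X$, $\lambda\ge0$; absolutely homogeneous if $f(\lambda x)=|\lambda|f(x)$ for all $x\in X$, $\lambda\in\mathbb{R}$; $2$-homogeneous if $f(2x)=2f(x)$ for all $x\in X$; subadditive if $f(x+y)\le f(x)+f(y)$ for all $x,y\in X$; even if $f(-x)=f(x)$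 for all $x\in X$. No translation-invariance or continuity of the vector space operations is assumed. *)

theory Defs
  imports "HOL-Algebra.Algebraic_Closure_Type" "HOL-Analysis.Analysis"
begin

(* A real vector space is a module, with explicit carrier, over the field of reals.  The qualifier
   separates the carrier-based locale of HOL-Algebra from the type-class based one of HOL.Modules. *)
abbreviation real_vspace :: "(real, 'a, 'm) module_scheme \<Rightarrow> bool" where
  "real_vspace V \<equiv> Module.module (ring_of_type_algebra :: real ring) V"

(* Only the additive group and the scalar multiplication matter; the ring fields "mult" and "one"
   are present because HOL-Algebra's module record extends the ring record. *)
definition prod_vspace ::
    "'i set \<Rightarrow> ('i \<Rightarrow> (real, 'a, 'm) module_scheme) \<Rightarrow> (real, 'i \<Rightarrow> 'a) module" where
  "prod_vspace I V =
     \<lparr> carrier = (\<Pi>\<^sub>E i\<in>I. carrier (V i)),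
       monoid.mult = (\<lambda>x y. \<lambda>i\<in>I. x i \<otimes>\<^bsub>V i\<^esub> y i),
       monoid.one = (\<lambda>i\<in>I. \<one>\<^bsub>V i\<^esub>),
       ring.zero = (\<lambda>i\<in>I. \<zero>\<^bsub>V i\<^esub>),
       add = (\<lambda>x y. \<lambda>i\<in>I. x i \<oplus>\<^bsub>V i\<^esub> y i),
       module.smult = (\<lambda>c x. \<lambda>i\<in>I. c \<odot>\<^bsub>V i\<^esub> x i) \<rparr>"

lemma real_vspace_prod_vspace:
  assumes "\<And>i. i \<in> I \<Longrightarrow> real_vspace (V i)"
  shows "real_vspace (prod_vspace I V)"
proof -
  let ?R = "ring_of_type_algebra :: real ring"
  have ag: "abelian_group (V i)" if "i \<in> I" for i
    using assms[OF that] by (simp add: Module.module_def)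
  have agp: "abelian_group (prod_vspace I V)"
  proof (rule abelian_groupI)
    fix x assume x: "x \<in> carrier (prod_vspace I V)"
    show "\<exists>y\<in>carrier (prod_vspace I V).
            y \<oplus>\<^bsub>prod_vspace I V\<^esub> x = \<zero>\<^bsub>prod_vspace I V\<^esub>"
      using x ag
      by (intro bexI[of _ "\<lambda>i\<in>I. \<ominus>\<^bsub>V i\<^esub> x i"])
         (auto simp: prod_vspace_def PiE_iff abelian_group.l_neg abelian_group.a_inv_closed
            intro!: restrict_ext)
  qed (use ag in \<open>auto simp: prod_vspace_def PiE_iff extensional_def fun_eq_iff
          abelian_monoid.a_closed[OF abelian_group.axioms(1)]
          abelian_monoid.zero_closed[OF abelian_group.axioms(1)]
          abelian_monoid.a_assoc[OF abelian_group.axioms(1)]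
          abelian_monoid.l_zero[OF abelian_group.axioms(1)]
          intro: abelian_monoid.a_comm[OF abelian_group.axioms(1)]\<close>)
  show ?thesis
  proof (rule moduleI)
    show "cring ?R" by (rule cring_from_type_algebra)
  qed (use agp in \<open>auto simp: prod_vspace_def PiE_iff extensional_def fun_eq_iff
          Module.module.smult_l_distr[OF assms] Module.module.smult_assoc1[OF assms]
          Module.module.smult_r_distr[OF assms] Module.module.smult_one[OF assms]
          intro: Module.module.smult_closed[OF assms]\<close>)
qed

definition dist_zero :: "(real, 'a, 'm) module_scheme \<Rightarrow> ('a \<Rightarrow> 'a \<Rightarrow> real) \<Rightarrow> 'a \<Rightarrow> real" where
  "dist_zero V d x = d x \<zero>\<^bsub>V\<^esub>"

(* d_(psi_p) for extended real p in [1, \<infinity>]. *)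
definition d_psi :: "'i set \<Rightarrow> ('i \<Rightarrow> 'a \<Rightarrow> 'a \<Rightarrow> real) \<Rightarrow> ereal \<Rightarrow> ('i \<Rightarrow> 'a) \<Rightarrow> ('i \<Rightarrow> 'a) \<Rightarrow> real" where
  "d_psi I d p x y =
     (if p = \<infinity> then Max ((\<lambda>i. d i (x i) (y i)) ` I)
      else (\<Sum>i\<in>I. d i (x i) (y i) powr real_of_ereal p) powr (1 / real_of_ereal p))"

(* The supremum is taken in the extended reals, as it may be infinite. *)
definition C_NJ :: "(real, 'a, 'm) module_scheme \<Rightarrow> ('a \<Rightarrow> 'a \<Rightarrow> real) \<Rightarrow> real \<Rightarrow> ereal" where
  "C_NJ V d \<sigma> =
     (let f = dist_zero V d in
      SUP (x, y) \<in> carrier V \<times> carrier V - {(\<zero>\<^bsub>V\<^esub>, \<zero>\<^bsub>V\<^esub>)}.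
        ereal ((f (x \<oplus>\<^bsub>V\<^esub> y) powr \<sigma> + f (x \<ominus>\<^bsub>V\<^esub> y) powr \<sigma>)
               / (2 powr (\<sigma> - 1) * (f x powr \<sigma> + f y powr \<sigma>))))"

(* Meant for 1 < \<alpha> \<le> 2 and 1/\<alpha> + 1/\<beta> = 1. *)
definition clarkson :: "(real, 'a, 'm) module_scheme \<Rightarrow> ('a \<Rightarrow> real) \<Rightarrow> real \<Rightarrow> real \<Rightarrow> bool" where
  "clarkson V f \<alpha> \<beta> \<longleftrightarrow>
     (\<forall>x\<in>carrier V. \<forall>y\<in>carrier V.
        f (x \<oplus>\<^bsub>V\<^esub> y) powr \<beta> + f (x \<ominus>\<^bsub>V\<^esub> y) powr \<beta>
          \<le> 2 * (f x powr \<alpha> + f y powr \<alpha>) powr (\<beta> / \<alpha>))"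

definition pos_homogeneous :: "(real, 'a, 'm) module_scheme \<Rightarrow> ('a \<Rightarrow> real) \<Rightarrow> bool" where
  "pos_homogeneous V f \<longleftrightarrow> (\<forall>x\<in>carrier V. \<forall>c\<ge>0. f (c \<odot>\<^bsub>V\<^esub> x) = c * f x)"

definition abs_homogeneous :: "(real, 'a, 'm) module_scheme \<Rightarrow> ('a \<Rightarrow> real) \<Rightarrow> bool" where
  "abs_homogeneous V f \<longleftrightarrow> (\<forall>x\<in>carrier V. \<forall>c. f (c \<odot>\<^bsub>V\<^esub> x) = \<bar>c\<bar> * f x)"

definition two_homogeneous :: "(real, 'a, 'm) module_scheme \<Rightarrow> ('a \<Rightarrow> real) \<Rightarrow> bool" where
  "two_homogeneous V f \<longleftrightarrow> (\<forall>x\<in>carrier V. f (2 \<odot>\<^bsub>V\<^esub> x) = 2 * f x)"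

definition subadditive_on :: "(real, 'a, 'm) module_scheme \<Rightarrow> ('a \<Rightarrow> real) \<Rightarrow> bool" where
  "subadditive_on V f \<longleftrightarrow>
     (\<forall>x\<in>carrier V. \<forall>y\<in>carrier V. f (x \<oplus>\<^bsub>V\<^esub> y) \<le> f x + f y)"

definition even_on :: "(real, 'a, 'm) module_scheme \<Rightarrow> ('a \<Rightarrow> real) \<Rightarrow> bool" where
  "even_on V f \<longleftrightarrow> (\<forall>x\<in>carrier V. f (\<ominus>\<^bsub>V\<^esub> x) = f x)"

end

(* All three assertions have the form C_NJ = 2 powr (\<sigma>/\<alpha> - \<sigma> + 1), with \<alpha> = p in (i), \<alpha> = q in (ii) and
   \<alpha> = 1 in (iii).  By Minkowski's inequality the Clarkson inequality passes from the factors to the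
   product; the power mean inequality, applied once on each side, then gives the upper bound.
   Subadditive even functions satisfy a Clarkson inequality with \<alpha> = 1 and \<beta> = \<sigma>.  Equality occurs
   for unit vectors u, v of the two distinguished factors: at (u,0), (0,v) in (i) and for d_(psi_1),
   and at (u,v), (u,-v) in (ii) and for d_(psi_\<infinity>). *)

theory Submission
  imports Defs
begin

section \<open>Power means and Minkowski's inequality\<close>

text \<open>For positive arguments this is convexity of the power function. If one argument
  vanishes, it reduces to \<open>s powr r \<le> s\<close> for s in [0,1].\<close>

lemma powr_convex_nonneg:
  fixes a b r t :: real
  assumes "0 \<le> a" "0 \<le> b" "1 \<le> r" "0 \<le> t" "t \<le> 1"
  shows "((1 - t) * a + t * b) powr r \<le> (1 - t) * a powr r + t * b powr r"
proof -
  have scale: "(s * c) powr r \<le> s * c powr r" if "0 \<le> s" "s \<le> 1" "0 \<le> c" for s c :: real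
  proof -
    have "s powr r \<le> s"
      using powr_mono'[of 1 r s] that assms(3) by (cases "s = 0") auto
    then show ?thesis
      using that by (simp add: powr_mult mult_right_mono)
  qed
  consider "a = 0" | "b = 0" | "0 < a" "0 < b"
    using assms by fastforce
  then show ?thesis
  proof cases
    case 1
    then show ?thesis using scale[of t b] assms by simp
  next
    case 2
    then show ?thesis using scale[of "1 - t" a] assms by simp
  next
    case 3
    then show ?thesis
      using convex_onD[OF powr_convex[OF assms(3)], of t a b] assms by simp
  qed
qed

text \<open>Convexity at the midpoint, scaled by \<open>2 powr r\<close>. It is the power mean
  inequality behind both constants in the upper bound.\<close>

lemma powr_add_le:
  fixes a b r :: real
  assumes "0 \<le> a" "0 \<le> b" "1 \<le> r"
  shows "(a + b) powr r \<le> 2 powr (r - 1) * (a powr r + b powr r)"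
proof -
  have "(a + b) powr r = 2 powr r * ((1 - 1/2) * a + 1/2 * b) powr r"
    using assms by (subst powr_mult[symmetric]) auto
  also have "\<dots> \<le> 2 powr r * ((1 - 1/2) * a powr r + 1/2 * b powr r)"
    using powr_convex_nonneg[OF assms, of "1/2"] by (intro mult_left_mono) auto
  also have "\<dots> = 2 powr (r - 1) * (a powr r + b powr r)"
    by (simp add: powr_diff field_simps)
  finally show ?thesis .
qed

text \<open>Free of vector spaces, so that it measures points of the product as well as pairs of
  numbers indexed by \<open>bool\<close>.\<close>

definition lp_norm :: "'i set \<Rightarrow> real \<Rightarrow> ('i \<Rightarrow> real) \<Rightarrow> real" where
  "lp_norm I p a = (\<Sum>i\<in>I. a i powr p) powr (1 / p)"

lemma lp_norm_nonneg: "0 \<le> lp_norm I p a"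
  by (simp add: lp_norm_def)

lemma lp_norm_powr: "lp_norm I p a powr s = (\<Sum>i\<in>I. a i powr p) powr (s / p)"
  by (simp add: lp_norm_def powr_powr)

lemma lp_norm_powr_self:
  assumes "p \<noteq> 0"
  shows "lp_norm I p a powr p = (\<Sum>i\<in>I. a i powr p)"
  using assms by (simp add: lp_norm_powr sum_nonneg)

lemma lp_norm_eq_0D:
  assumes "finite I" "i \<in> I" "lp_norm I p a = 0"
  shows "a i = 0"
proof -
  have "(\<Sum>i\<in>I. a i powr p) = 0"
    using assms(3) by (simp add: lp_norm_def)
  then have "a i powr p = 0"
    using assms(1,2) by (simp add: sum_nonneg_eq_0_iff)
  then show ?thesis by simp
qed

text \<open>If one norm vanishes, so does that function on \<open>I\<close>. Otherwise each summand
  is written as \<open>A + B\<close> times a convex combination of normalised entries; after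
  convexity of \<open>powr r\<close> the normalised r-th powers sum to 1.\<close>

lemma lp_norm_Minkowski:
  assumes fin: "finite I" and r: "1 \<le> r"
    and a: "\<And>i. i \<in> I \<Longrightarrow> 0 \<le> a i" and b: "\<And>i. i \<in> I \<Longrightarrow> 0 \<le> b i"
  shows "lp_norm I r (\<lambda>i. a i + b i) \<le> lp_norm I r a + lp_norm I r b"
proof -
  define A B where "A = lp_norm I r a" and "B = lp_norm I r b"
  have AB: "0 \<le> A" "0 \<le> B" by (simp_all add: A_def B_def lp_norm_nonneg)
  consider "A = 0" | "B = 0" | "0 < A" "0 < B" using AB by fastforce
  then show ?thesis
  proof cases
    case 1
    then have "a i = 0" if "i \<in> I" for i
      using lp_norm_eq_0D[OF fin that] by (simp add: A_def)
    then have "lp_norm I r (\<lambda>i. a i + b i) = B"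
      by (simp add: lp_norm_def B_def)
    then show ?thesis using AB by (simp add: A_def B_def)
  next
    case 2
    then have "b i = 0" if "i \<in> I" for i
      using lp_norm_eq_0D[OF fin that] by (simp add: B_def)
    then have "lp_norm I r (\<lambda>i. a i + b i) = A"
      by (simp add: lp_norm_def A_def)
    then show ?thesis using AB by (simp add: A_def B_def)
  next
    case 3
    \<comment> \<open>This weight cancels the normalisations: \<open>(1 - t) / A\<close> and
      \<open>t / B\<close> both equal \<open>1 / (A + B)\<close>.\<close>
    define t where "t = B / (A + B)"
    have t: "0 \<le> t" "t \<le> 1" "1 - t = A / (A + B)"
      using 3 by (simp_all add: t_def field_simps)
    have Ar: "(\<Sum>i\<in>I. a i powr r) = A powr r" and Br: "(\<Sum>i\<in>I. b i powr r) = B powr r"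
      using r by (simp_all add: A_def B_def lp_norm_powr_self)
    have "(\<Sum>i\<in>I. (a i + b i) powr r) = (\<Sum>i\<in>I. (A + B) powr r * ((1 - t) * (a i / A) + t * (b i / B)) powr r)"
    proof (rule sum.cong[OF refl])
      fix i assume i: "i \<in> I"
      have "a i + b i = (A + B) * ((1 - t) * (a i / A) + t * (b i / B))"
      proof -
        have "(1 - t) * (a i / A) = a i / (A + B)" "t * (b i / B) = b i / (A + B)"
          unfolding t(3) using 3 by (simp_all add: t_def)
        then show ?thesis using 3 by (simp add: add_divide_distrib[symmetric])
      qed
      moreover have "0 \<le> (1 - t) * (a i / A) + t * (b i / B)"
        using t 3 a[OF i] b[OF i] by simp
      ultimately show "(a i + b i) powr r = (A + B) powr r * ((1 - t) * (a i / A) + t * (b i / B)) powr r"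
        using 3 by (simp add: powr_mult)
    qed
    also have "\<dots> \<le> (\<Sum>i\<in>I. (A + B) powr r * ((1 - t) * (a i / A) powr r + t * (b i / B) powr r))"
      using t 3 a b r by (intro sum_mono mult_left_mono powr_convex_nonneg) auto
    also have "\<dots> = (\<Sum>i\<in>I. (A + B) powr r * ((1 - t) * (a i powr r / A powr r) + t * (b i powr r / B powr r)))"
      using 3 a b by (intro sum.cong) (auto simp: powr_divide)
    also have "\<dots> = (A + B) powr r * ((1 - t) * ((\<Sum>i\<in>I. a i powr r) / A powr r) + t * ((\<Sum>i\<in>I. b i powr r) / B powr r))"
      by (simp add: sum_distrib_left sum_divide_distrib sum.distrib distrib_left)
    also have "\<dots> = (A + B) powr r"
      using 3 by (simp add: Ar Br)
    finally have "lp_norm I r (\<lambda>i. a i + b i) \<le> ((A + B) powr r) powr (1 / r)"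
      unfolding lp_norm_def using r by (intro powr_mono2) (auto intro: sum_nonneg)
    also have "\<dots> = A + B"
      using 3 r by (simp add: powr_powr)
    finally show ?thesis by (simp add: A_def B_def)
  qed
qed

text \<open>Minkowski for finitely many vectors. It is applied below with the factors of the product
  as the index set \<open>K\<close> of the sum.\<close>

lemma lp_norm_sum_le:
  assumes "finite K" "finite I" "1 \<le> r"
    and "\<And>k i. k \<in> K \<Longrightarrow> i \<in> I \<Longrightarrow> 0 \<le> a k i"
  shows "lp_norm I r (\<lambda>i. \<Sum>k\<in>K. a k i) \<le> (\<Sum>k\<in>K. lp_norm I r (a k))"
  using assms(1,4)
proof (induction K rule: finite_induct)
  case empty
  then show ?case by (simp add: lp_norm_def)
next
  case (insert k K)
  have "lp_norm I r (\<lambda>i. a k i + (\<Sum>k\<in>K. a k i)) \<le> lp_norm I r (a k) + lp_norm I r (\<lambda>i. \<Sum>k\<in>K. a k i)"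
    using insert.prems assms(2,3) by (intro lp_norm_Minkowski) (auto intro: sum_nonneg)
  also have "\<dots> \<le> lp_norm I r (a k) + (\<Sum>k\<in>K. lp_norm I r (a k))"
    using insert by (intro add_left_mono insert.IH) auto
  finally show ?case
    using insert.hyps by simp
qed

section \<open>Clarkson inequalities for numbers\<close>

text \<open>With r = q/p, each pair (\<open>A k powr p\<close>, \<open>B k powr p\<close>) is a
  vector in the plane with the r-norm. Minkowski over k bounds the norm of the total by the sum of
  the norms; the hypothesis bounds each of these by \<open>2 powr (1 / r)\<close> times a term that
  is additive in k.\<close>

lemma lp_norm_clarkson_le:
  assumes fin: "finite K" and p: "0 < p" "p \<le> q"
    and cl: "\<And>k. k \<in> K \<Longrightarrow> A k powr q + B k powr q \<le> 2 * (C k powr p + D k powr p) powr (q / p)"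
  shows "lp_norm K p A powr q + lp_norm K p B powr q
    \<le> 2 * (lp_norm K p C powr p + lp_norm K p D powr p) powr (q / p)"
proof -
  define r where "r = q / p"
  have r: "1 \<le> r" using p by (simp add: r_def)
  have pr: "p * r = q" using p by (simp add: r_def)
  \<comment> \<open>The Boolean c selects the sum or the difference, so the two-point space is
    \<open>UNIV :: bool set\<close>.\<close>
  define a where "a k c = (if c then A k powr p else B k powr p)" for k c
  have two: "lp_norm UNIV r g = (g True powr r + g False powr r) powr (1 / r)" for g
    by (simp add: lp_norm_def UNIV_bool add.commute)
  have "((\<Sum>k\<in>K. A k powr p) powr r + (\<Sum>k\<in>K. B k powr p) powr r) powr (1 / r)
      = lp_norm UNIV r (\<lambda>c. \<Sum>k\<in>K. a k c)"
    by (simp add: two a_def)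
  also have "\<dots> \<le> (\<Sum>k\<in>K. lp_norm UNIV r (a k))"
    by (rule lp_norm_sum_le) (use fin r in \<open>auto simp: a_def\<close>)
  also have "\<dots> = (\<Sum>k\<in>K. (A k powr q + B k powr q) powr (1 / r))"
    by (simp add: two a_def powr_powr pr)
  also have "\<dots> \<le> (\<Sum>k\<in>K. (2 * (C k powr p + D k powr p) powr r) powr (1 / r))"
    using cl r p by (intro sum_mono powr_mono2) (auto simp: r_def)
  also have "\<dots> = (\<Sum>k\<in>K. 2 powr (1 / r) * (C k powr p + D k powr p))"
    using r by (intro sum.cong) (auto simp: powr_mult powr_powr)
  also have "\<dots> = 2 powr (1 / r) * (lp_norm K p C powr p + lp_norm K p D powr p)"
    using p by (simp add: lp_norm_powr_self sum.distrib flip: sum_distrib_left)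
  finally have "(((\<Sum>k\<in>K. A k powr p) powr r + (\<Sum>k\<in>K. B k powr p) powr r) powr (1 / r)) powr r
      \<le> (2 powr (1 / r) * (lp_norm K p C powr p + lp_norm K p D powr p)) powr r"
    using r by (intro powr_mono2) auto
  then show ?thesis
    unfolding lp_norm_powr[of K p A q] lp_norm_powr[of K p B q] r_def[symmetric]
    using r by (simp add: powr_powr powr_mult)
qed

text \<open>Here the outer exponent is that of the norm, so the left side is additive in k and the
  hypothesis can be summed. Minkowski, with r = p/q over \<open>K\<close>, is needed on the right
  side instead.\<close>

lemma lp_norm_clarkson_ge:
  assumes fin: "finite K" and p: "0 < q" "q \<le> p"
    and cl: "\<And>k. k \<in> K \<Longrightarrow> A k powr p + B k powr p \<le> 2 * (C k powr q + D k powr q) powr (p / q)"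
  shows "lp_norm K p A powr p + lp_norm K p B powr p
    \<le> 2 * (lp_norm K p C powr q + lp_norm K p D powr q) powr (p / q)"
proof -
  define r where "r = p / q"
  have r: "1 \<le> r" and qr: "q * r = p" using p by (simp_all add: r_def)
  \<comment> \<open>The q-th power of a p-norm is an r-norm of q-th powers, which makes the right
    side accessible to Minkowski.\<close>
  have C: "lp_norm K r (\<lambda>k. C k powr q) = lp_norm K p C powr q" for C :: "'a \<Rightarrow> real"
    unfolding lp_norm_powr using p by (simp add: lp_norm_def powr_powr qr) (simp add: r_def)
  have "lp_norm K p A powr p + lp_norm K p B powr p = (\<Sum>k\<in>K. A k powr p + B k powr p)"
    using p by (simp add: lp_norm_powr_self sum.distrib)
  also have "\<dots> \<le> (\<Sum>k\<in>K. 2 * (C k powr q + D k powr q) powr r)"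
    using cl by (intro sum_mono) (auto simp: r_def)
  also have "\<dots> = 2 * lp_norm K r (\<lambda>k. C k powr q + D k powr q) powr r"
    using r by (simp add: lp_norm_powr_self sum_distrib_left)
  also have "\<dots> \<le> 2 * (lp_norm K p C powr q + lp_norm K p D powr q) powr r"
    using lp_norm_Minkowski[OF fin r, of "\<lambda>k. C k powr q" "\<lambda>k. D k powr q"] r
    by (intro mult_left_mono powr_mono2) (auto simp: C lp_norm_nonneg)
  finally show ?thesis by (simp add: r_def)
qed

text \<open>The power mean inequality with exponent \<beta>/\<sigma> raises the left side to order
  \<beta>, where the hypothesis applies; with exponent \<sigma>/\<alpha> it brings the right side
  back to order \<sigma>. The ordering of \<alpha>, \<sigma>, \<beta> makes both exponents at least
  1.\<close>

lemma clarkson_imp_NJ_bound: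
  fixes A B C D :: real
  assumes ord: "0 < \<alpha>" "\<alpha> \<le> \<sigma>" "\<sigma> \<le> \<beta>"
    and cl: "A powr \<beta> + B powr \<beta> \<le> 2 * (C powr \<alpha> + D powr \<alpha>) powr (\<beta> / \<alpha>)"
  shows "A powr \<sigma> + B powr \<sigma> \<le> 2 powr (\<sigma> / \<alpha>) * (C powr \<sigma> + D powr \<sigma>)"
proof -
  define S where "S = C powr \<alpha> + D powr \<alpha>"
  have S: "0 \<le> S" by (simp add: S_def)
  have "(A powr \<sigma> + B powr \<sigma>) powr (\<beta> / \<sigma>) \<le> 2 powr (\<beta> / \<sigma> - 1) * (A powr \<beta> + B powr \<beta>)"
    using powr_add_le[of "A powr \<sigma>" "B powr \<sigma>" "\<beta> / \<sigma>"] ord by (simp add: powr_powr)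
  also have "\<dots> \<le> 2 powr (\<beta> / \<sigma> - 1) * (2 * S powr (\<beta> / \<alpha>))"
    using cl by (intro mult_left_mono) (auto simp: S_def)
  also have "\<dots> = 2 powr (\<beta> / \<sigma>) * S powr (\<beta> / \<alpha>)"
    by (simp add: powr_diff)
  finally have "((A powr \<sigma> + B powr \<sigma>) powr (\<beta> / \<sigma>)) powr (\<sigma> / \<beta>)
      \<le> (2 powr (\<beta> / \<sigma>) * S powr (\<beta> / \<alpha>)) powr (\<sigma> / \<beta>)"
    using ord by (intro powr_mono2) auto
  then have "A powr \<sigma> + B powr \<sigma> \<le> 2 * S powr (\<sigma> / \<alpha>)"
    using ord S by (simp add: powr_powr powr_mult)
  also have "\<dots> \<le> 2 * (2 powr (\<sigma> / \<alpha> - 1) * (C powr \<sigma> + D powr \<sigma>))"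
    using powr_add_le[of "C powr \<alpha>" "D powr \<alpha>" "\<sigma> / \<alpha>"] ord
    by (simp add: S_def powr_powr)
  also have "\<dots> = 2 powr (\<sigma> / \<alpha>) * (C powr \<sigma> + D powr \<sigma>)"
    by (simp add: powr_diff)
  finally show ?thesis .
qed

text \<open>The case \<alpha> = 1, \<beta> = \<sigma>, where the Clarkson inequality just says that
  both left terms are at most \<open>(C + D) powr \<sigma>\<close>. The form
  \<open>\<sigma> / 1\<close> matches the general bound.\<close>

lemma subadditive_imp_NJ_bound:
  fixes A B C D :: real
  assumes "0 \<le> A" "0 \<le> B" "0 \<le> C" "0 \<le> D" "A \<le> C + D" "B \<le> C + D" "1 \<le> \<sigma>"
  shows "A powr \<sigma> + B powr \<sigma> \<le> 2 powr (\<sigma> / 1) * (C powr \<sigma> + D powr \<sigma>)"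
proof (rule clarkson_imp_NJ_bound)
  have "A powr \<sigma> \<le> (C + D) powr \<sigma>" "B powr \<sigma> \<le> (C + D) powr \<sigma>"
    using assms by (auto intro: powr_mono2)
  then show "A powr \<sigma> + B powr \<sigma> \<le> 2 * (C powr 1 + D powr 1) powr (\<sigma> / 1)"
    using assms by simp
qed (use assms in auto)

section \<open>Products of metric vector spaces\<close>

text \<open>The bound caps every quotient of the supremum, and the given x, y attain the cap: theirs
  is \<open>2 powr (\<sigma> / \<alpha>) / 2 powr (\<sigma> - 1)\<close>, as s cancels.\<close>

lemma C_NJ_eqI:
  fixes \<alpha> \<sigma> :: real
  assumes bound: "\<And>x y. x \<in> carrier W \<Longrightarrow> y \<in> carrier W \<Longrightarrow>
      dist_zero W e (x \<oplus>\<^bsub>W\<^esub> y) powr \<sigma> + dist_zero W e (x \<ominus>\<^bsub>W\<^esub> y) powr \<sigma>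
        \<le> 2 powr (\<sigma> / \<alpha>) * (dist_zero W e x powr \<sigma> + dist_zero W e y powr \<sigma>)"
    and xy: "x \<in> carrier W" "y \<in> carrier W" "x \<noteq> \<zero>\<^bsub>W\<^esub>"
    and s: "dist_zero W e x = s" "dist_zero W e y = s" "0 < s"
    and t: "dist_zero W e (x \<oplus>\<^bsub>W\<^esub> y) = 2 powr (1 / \<alpha>) * s"
      "dist_zero W e (x \<ominus>\<^bsub>W\<^esub> y) = 2 powr (1 / \<alpha>) * s"
  shows "C_NJ W e \<sigma> = ereal (2 powr (\<sigma> / \<alpha> - \<sigma> + 1))"
proof -
  let ?F = "dist_zero W e"
  let ?Q = "\<lambda>x y. (?F (x \<oplus>\<^bsub>W\<^esub> y) powr \<sigma> + ?F (x \<ominus>\<^bsub>W\<^esub> y) powr \<sigma>)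
    / (2 powr (\<sigma> - 1) * (?F x powr \<sigma> + ?F y powr \<sigma>))"
  have c: "2 powr (\<sigma> / \<alpha> - \<sigma> + 1) = 2 powr (\<sigma> / \<alpha>) / 2 powr (\<sigma> - 1)"
    by (simp add: powr_diff[symmetric] algebra_simps)
  have le: "?Q x y \<le> 2 powr (\<sigma> / \<alpha> - \<sigma> + 1)" if "x \<in> carrier W" "y \<in> carrier W" for x y
  proof (cases "?F x powr \<sigma> + ?F y powr \<sigma> = 0")
    case False
    then have "0 < ?F x powr \<sigma> + ?F y powr \<sigma>"
      by (simp add: less_le)
    then show ?thesis
      using bound[OF that] unfolding c
      by (subst mult.commute, subst divide_divide_eq_left[symmetric])
        (intro divide_right_mono, auto simp: pos_divide_le_eq)
  qed simp
  have eq: "?Q x y = 2 powr (\<sigma> / \<alpha> - \<sigma> + 1)"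
    unfolding c s t using s(3) by (simp add: powr_mult powr_powr)
  show ?thesis
    unfolding C_NJ_def Let_def
  proof (rule antisym)
    show "(SUP (x, y)\<in>carrier W \<times> carrier W - {(\<zero>\<^bsub>W\<^esub>, \<zero>\<^bsub>W\<^esub>)}. ereal (?Q x y))
        \<le> ereal (2 powr (\<sigma> / \<alpha> - \<sigma> + 1))"
      using le by (intro SUP_least) auto
    show "ereal (2 powr (\<sigma> / \<alpha> - \<sigma> + 1))
        \<le> (SUP (x, y)\<in>carrier W \<times> carrier W - {(\<zero>\<^bsub>W\<^esub>, \<zero>\<^bsub>W\<^esub>)}. ereal (?Q x y))"
      using xy by (intro SUP_upper2[of "(x, y)"]) (auto simp: eq)
  qed
qed

lemma abs_imp_pos_homogeneous: "abs_homogeneous W g \<Longrightarrow> pos_homogeneous W g"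
  by (simp add: pos_homogeneous_def abs_homogeneous_def)

section \<open>Coordinates and lengths in a finite product\<close>

locale metric_vspace_family =
  fixes I :: "'i set" and V :: "'i \<Rightarrow> (real, 'a, 'm) module_scheme" and d :: "'i \<Rightarrow> 'a \<Rightarrow> 'a \<Rightarrow> real"
  assumes finite_I: "finite I"
    and vspace: "\<And>k. k \<in> I \<Longrightarrow> real_vspace (V k)"
    and metric: "\<And>k. k \<in> I \<Longrightarrow> Metric_space (carrier (V k)) (d k)"
begin

abbreviation P where "P \<equiv> prod_vspace I V"

definition f where "f k = dist_zero (V k) (d k)"

lemma abelian: "k \<in> I \<Longrightarrow> abelian_group (V k)"
  using vspace by (simp add: Module.module_def)

lemma zero_closed: "k \<in> I \<Longrightarrow> \<zero>\<^bsub>V k\<^esub> \<in> carrier (V k)"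
  by (rule abelian_monoid.zero_closed[OF abelian_group.axioms(1)[OF abelian]])

lemma f_nonneg: "k \<in> I \<Longrightarrow> 0 \<le> f k x"
  by (simp add: f_def dist_zero_def Metric_space.nonneg[OF metric])

lemma f_eq_0_iff: "k \<in> I \<Longrightarrow> x \<in> carrier (V k) \<Longrightarrow> f k x = 0 \<longleftrightarrow> x = \<zero>\<^bsub>V k\<^esub>"
  by (simp add: f_def dist_zero_def Metric_space.zero[OF metric] zero_closed)

lemma f_zero: "k \<in> I \<Longrightarrow> f k \<zero>\<^bsub>V k\<^esub> = 0"
  by (simp add: f_eq_0_iff zero_closed)

lemma carrier_P: "carrier P = (\<Pi>\<^sub>E k\<in>I. carrier (V k))"
  by (simp add: prod_vspace_def)

lemma P_abelian: "abelian_group P"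
  using real_vspace_prod_vspace[of I V] vspace by (simp add: Module.module_def)

lemma P_add: "k \<in> I \<Longrightarrow> (x \<oplus>\<^bsub>P\<^esub> y) k = x k \<oplus>\<^bsub>V k\<^esub> y k"
  by (simp add: prod_vspace_def)

lemma P_zero: "k \<in> I \<Longrightarrow> \<zero>\<^bsub>P\<^esub> k = \<zero>\<^bsub>V k\<^esub>"
  by (simp add: prod_vspace_def)

lemma P_uminus:
  assumes "k \<in> I" "y \<in> carrier P"
  shows "(\<ominus>\<^bsub>P\<^esub> y) k = \<ominus>\<^bsub>V k\<^esub> y k"
proof -
  have c: "\<ominus>\<^bsub>P\<^esub> y \<in> carrier P" by (rule abelian_group.a_inv_closed[OF P_abelian assms(2)])
  have "\<ominus>\<^bsub>P\<^esub> y \<oplus>\<^bsub>P\<^esub> y = \<zero>\<^bsub>P\<^esub>"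
    by (rule abelian_group.l_neg[OF P_abelian assms(2)])
  then have "(\<ominus>\<^bsub>P\<^esub> y) k \<oplus>\<^bsub>V k\<^esub> y k = \<zero>\<^bsub>V k\<^esub>"
    using P_add[OF assms(1)] P_zero[OF assms(1)] by metis
  then show ?thesis
    using abelian_group.minus_equality[OF abelian[OF assms(1)]] c assms
    by (metis PiE_mem carrier_P)
qed

lemma P_minus: "k \<in> I \<Longrightarrow> y \<in> carrier P \<Longrightarrow> (x \<ominus>\<^bsub>P\<^esub> y) k = x k \<ominus>\<^bsub>V k\<^esub> y k"
  by (simp add: a_minus_def P_add P_uminus)

lemma dist_zero_P:
  "dist_zero P (d_psi I d (ereal p)) x = lp_norm I p (\<lambda>k. f k (x k))"
  by (simp add: dist_zero_def d_psi_def lp_norm_def f_def P_zero)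

lemma dist_zero_P_infinity:
  "dist_zero P (d_psi I d \<infinity>) x = Max ((\<lambda>k. f k (x k)) ` I)"
  by (simp add: dist_zero_def d_psi_def f_def P_zero)

text \<open>The additive inverse is scalar multiplication by -1, once the inverse of one in the
  carrier-based ring is identified with the real number -1.\<close>

lemma f_uminus:
  assumes "k \<in> I" "abs_homogeneous (V k) (f k)" "x \<in> carrier (V k)"
  shows "f k (\<ominus>\<^bsub>V k\<^esub> x) = f k x"
proof -
  let ?R = "ring_of_type_algebra :: real ring"
  interpret Module.module ?R "V k" by (rule vspace[OF assms(1)])
  have "\<ominus>\<^bsub>?R\<^esub> \<one>\<^bsub>?R\<^esub> = -1"
    by (rule R.minus_equality) (auto simp: ring_of_type_algebra_def)
  moreover have "(\<ominus>\<^bsub>?R\<^esub> \<one>\<^bsub>?R\<^esub>) \<odot>\<^bsub>V k\<^esub> x = \<ominus>\<^bsub>V k\<^esub> x"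
    using assms(3) by (simp add: smult_l_minus)
  ultimately have "\<ominus>\<^bsub>V k\<^esub> x = (-1) \<odot>\<^bsub>V k\<^esub> x" by simp
  then show ?thesis
    using assms by (simp add: abs_homogeneous_def)
qed

lemma f_double:
  assumes "k \<in> I" "pos_homogeneous (V k) (f k)" "x \<in> carrier (V k)"
  shows "f k (x \<oplus>\<^bsub>V k\<^esub> x) = 2 * f k x"
proof -
  let ?R = "ring_of_type_algebra :: real ring"
  interpret Module.module ?R "V k" by (rule vspace[OF assms(1)])
  have "x \<oplus>\<^bsub>V k\<^esub> x = (\<one>\<^bsub>?R\<^esub> \<oplus>\<^bsub>?R\<^esub> \<one>\<^bsub>?R\<^esub>) \<odot>\<^bsub>V k\<^esub> x"
    using assms(3) by (simp add: smult_l_distr)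
  also have "\<one>\<^bsub>?R\<^esub> \<oplus>\<^bsub>?R\<^esub> \<one>\<^bsub>?R\<^esub> = 2"
    by (simp add: ring_of_type_algebra_def)
  finally show ?thesis
    using assms by (simp add: pos_homogeneous_def)
qed

text \<open>Any nonzero vector is rescaled by the reciprocal of its length, a positive
  scalar.\<close>

lemma ex_unit:
  assumes "k \<in> I" "pos_homogeneous (V k) (f k)" "carrier (V k) \<noteq> {\<zero>\<^bsub>V k\<^esub>}"
  obtains u where "u \<in> carrier (V k)" "f k u = 1"
proof -
  obtain w where w: "w \<in> carrier (V k)" "w \<noteq> \<zero>\<^bsub>V k\<^esub>"
    using assms(3) zero_closed[OF assms(1)] by blast
  then have pos: "0 < f k w"
    using f_eq_0_iff[OF assms(1)] f_nonneg[OF assms(1), of w] by fastforce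
  show thesis
  proof
    show "(1 / f k w) \<odot>\<^bsub>V k\<^esub> w \<in> carrier (V k)"
      using Module.module.smult_closed[OF vspace[OF assms(1)], of "1 / f k w" w] w
      by (simp add: ring_of_type_algebra_def)
    show "f k ((1 / f k w) \<odot>\<^bsub>V k\<^esub> w) = 1"
      using assms(2) w pos by (simp add: pos_homogeneous_def)
  qed
qed

end

section \<open>Test vectors on two factors and the equality cases\<close>

locale two_factors = metric_vspace_family I V d
  for I :: "'i set" and V :: "'i \<Rightarrow> (real, 'a, 'm) module_scheme" and d +
  fixes i j :: 'i and u v :: 'a
  assumes ij: "i \<in> I" "j \<in> I" "i \<noteq> j"
    and hom_i: "pos_homogeneous (V i) (f i)" and hom_j: "abs_homogeneous (V j) (f j)"
    and u: "u \<in> carrier (V i)" "f i u = 1" and v: "v \<in> carrier (V j)" "f j v = 1"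
begin

definition pair :: "'a \<Rightarrow> 'a \<Rightarrow> 'i \<Rightarrow> 'a" where
  "pair a b = (\<lambda>k\<in>I. if k = i then a else if k = j then b else \<zero>\<^bsub>V k\<^esub>)"

lemma pair_closed: "a \<in> carrier (V i) \<Longrightarrow> b \<in> carrier (V j) \<Longrightarrow> pair a b \<in> carrier P"
  using zero_closed by (auto simp: pair_def carrier_P)

lemma f_pair: "k \<in> I \<Longrightarrow> f k (pair a b k) = (if k = i then f i a else if k = j then f j b else 0)"
  by (simp add: pair_def f_zero)

lemma pair_neq_zero: "f i a \<noteq> 0 \<Longrightarrow> pair a b \<noteq> \<zero>\<^bsub>P\<^esub>"
  using f_pair[OF ij(1), of a b] P_zero[OF ij(1)] f_zero[OF ij(1)] by auto

lemma f_pair_add: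
  assumes "k \<in> I"
  shows "f k ((pair a b \<oplus>\<^bsub>P\<^esub> pair a' b') k) = f k (pair (a \<oplus>\<^bsub>V i\<^esub> a') (b \<oplus>\<^bsub>V j\<^esub> b') k)"
  using assms ij zero_closed[OF assms] abelian_monoid.r_zero[OF abelian_group.axioms(1)[OF abelian[OF assms]]]
  by (simp add: P_add pair_def)

lemma f_pair_minus:
  assumes "k \<in> I" "a' \<in> carrier (V i)" "b' \<in> carrier (V j)"
  shows "f k ((pair a b \<ominus>\<^bsub>P\<^esub> pair a' b') k) = f k (pair (a \<oplus>\<^bsub>V i\<^esub> \<ominus>\<^bsub>V i\<^esub> a') (b \<oplus>\<^bsub>V j\<^esub> \<ominus>\<^bsub>V j\<^esub> b') k)"
  using assms ij zero_closed[OF assms(1)] abelian_group.r_neg[OF abelian[OF assms(1)] zero_closed[OF assms(1)]]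
  by (simp add: P_minus pair_closed) (auto simp: pair_def a_minus_def)

definition F :: "ereal \<Rightarrow> ('i \<Rightarrow> 'a) \<Rightarrow> real" where
  "F p x = dist_zero P (d_psi I d p) x"

lemma F_pair:
  assumes "p \<noteq> 0"
  shows "F (ereal p) (pair a b) = (f i a powr p + f j b powr p) powr (1 / p)"
proof -
  have "(\<Sum>k\<in>I. f k (pair a b k) powr p) = (\<Sum>k\<in>{i, j}. f k (pair a b k) powr p)"
    using ij finite_I by (intro sum.mono_neutral_right) (auto simp: f_pair)
  also have "\<dots> = f i a powr p + f j b powr p"
    using ij by (simp add: f_pair)
  finally show ?thesis
    by (simp add: F_def dist_zero_P lp_norm_def)
qed

text \<open>The other coordinates have length 0, which cannot exceed the maximum because lengths are
  nonnegative.\<close>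

lemma F_infinity_pair: "F \<infinity> (pair a b) = max (f i a) (f j b)"
proof -
  have "Max ((\<lambda>k. f k (pair a b k)) ` I) = max (f i a) (f j b)"
  proof (rule Max_eqI)
    show "finite ((\<lambda>k. f k (pair a b k)) ` I)" using finite_I by simp
    show "y \<le> max (f i a) (f j b)" if "y \<in> (\<lambda>k. f k (pair a b k)) ` I" for y
      using that f_nonneg[OF ij(1), of a] by (auto simp: f_pair)
    have "f i a \<in> (\<lambda>k. f k (pair a b k)) ` I" "f j b \<in> (\<lambda>k. f k (pair a b k)) ` I"
      using ij f_pair by (auto intro!: rev_image_eqI)
    then show "max (f i a) (f j b) \<in> (\<lambda>k. f k (pair a b k)) ` I"
      by (simp add: max_def)
  qed
  then show ?thesis by (simp add: F_def dist_zero_P_infinity)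
qed

text \<open>\<open>F\<close> sees a vector only through its coordinate lengths, so sums and
  differences of test vectors may be compared by lengths, for finite and infinite p alike.\<close>

lemma F_cong:
  assumes "\<And>k. k \<in> I \<Longrightarrow> f k (x k) = f k (y k)"
  shows "F p x = F p y"
proof -
  have "d k (x k) \<zero>\<^bsub>V k\<^esub> = d k (y k) \<zero>\<^bsub>V k\<^esub>" if "k \<in> I" for k
    using assms[OF that] by (simp add: f_def dist_zero_def)
  then show ?thesis
    by (simp add: F_def dist_zero_def d_psi_def P_zero cong: image_cong sum.cong)
qed

lemma F_pair_add:
  "F p (pair a b \<oplus>\<^bsub>P\<^esub> pair a' b') = F p (pair (a \<oplus>\<^bsub>V i\<^esub> a') (b \<oplus>\<^bsub>V j\<^esub> b'))"
  by (intro F_cong f_pair_add)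

lemma F_pair_minus:
  "a' \<in> carrier (V i) \<Longrightarrow> b' \<in> carrier (V j) \<Longrightarrow>
   F p (pair a b \<ominus>\<^bsub>P\<^esub> pair a' b') = F p (pair (a \<oplus>\<^bsub>V i\<^esub> \<ominus>\<^bsub>V i\<^esub> a') (b \<oplus>\<^bsub>V j\<^esub> \<ominus>\<^bsub>V j\<^esub> b'))"
  by (intro F_cong) (simp add: f_pair_minus)

text \<open>The witnesses have length 1, while their sum and difference have unit coordinates in
  both factors and hence length \<open>2 powr (1 / p)\<close>. Only v is negated, so absolute
  homogeneity is used in factor j alone.\<close>

lemma C_NJ_eq_separate:
  assumes p: "0 < p"
    and bound: "\<And>x y. x \<in> carrier P \<Longrightarrow> y \<in> carrier P \<Longrightarrow>
      F (ereal p) (x \<oplus>\<^bsub>P\<^esub> y) powr \<sigma> + F (ereal p) (x \<ominus>\<^bsub>P\<^esub> y) powr \<sigma>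
        \<le> 2 powr (\<sigma> / p) * (F (ereal p) x powr \<sigma> + F (ereal p) y powr \<sigma>)"
  shows "C_NJ P (d_psi I d (ereal p)) \<sigma> = ereal (2 powr (\<sigma> / p - \<sigma> + 1))"
proof -
  interpret i: abelian_group "V i" by (rule abelian[OF ij(1)])
  interpret j: abelian_group "V j" by (rule abelian[OF ij(2)])
  have v': "f j (\<ominus>\<^bsub>V j\<^esub> v) = 1" using f_uminus[OF ij(2) hom_j v(1)] v by simp
  have zero: "\<ominus>\<^bsub>V i\<^esub> \<zero>\<^bsub>V i\<^esub> = \<zero>\<^bsub>V i\<^esub>" by (rule i.minus_equality) auto
  let ?x = "pair u \<zero>\<^bsub>V j\<^esub>" and ?y = "pair \<zero>\<^bsub>V i\<^esub> v"
  show ?thesis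
  proof (rule C_NJ_eqI[where W = P and e = "d_psi I d (ereal p)" and x = ?x and y = ?y and s = 1, folded F_def])
    show "?x \<in> carrier P" "?y \<in> carrier P" using u v by (auto intro: pair_closed)
    show "?x \<noteq> \<zero>\<^bsub>P\<^esub>" by (rule pair_neq_zero) (simp add: u)
  qed (use u v v' p ij in \<open>simp_all add: bound F_pair F_pair_add F_pair_minus f_zero zero\<close>)
qed

lemma F_diagonal_add:
  "F p (pair u v \<oplus>\<^bsub>P\<^esub> pair u (\<ominus>\<^bsub>V j\<^esub> v)) = F p (pair (u \<oplus>\<^bsub>V i\<^esub> u) \<zero>\<^bsub>V j\<^esub>)"
  using abelian_group.r_neg[OF abelian[OF ij(2)] v(1)] by (simp add: F_pair_add)

lemma F_diagonal_minus:
  "F p (pair u v \<ominus>\<^bsub>P\<^esub> pair u (\<ominus>\<^bsub>V j\<^esub> v)) = F p (pair \<zero>\<^bsub>V i\<^esub> (v \<oplus>\<^bsub>V j\<^esub> v))"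
proof -
  interpret i: abelian_group "V i" by (rule abelian[OF ij(1)])
  interpret j: abelian_group "V j" by (rule abelian[OF ij(2)])
  show ?thesis
    using u v by (simp add: F_pair_minus i.r_neg)
qed

text \<open>The sum of the witnesses is (u+u, 0) and their difference (0, v+v), both of length 2.
  The common length s of the witnesses is left abstract to serve finite p and \<infinity>
  together.\<close>

lemma C_NJ_eq_diagonal:
  assumes s: "0 < s" "2 = 2 powr (1 / \<alpha>) * s"
    and F: "\<And>a b. f i a = 1 \<Longrightarrow> f j b = 1 \<Longrightarrow> F p (pair a b) = s"
      "\<And>a. f i a = 2 \<Longrightarrow> F p (pair a \<zero>\<^bsub>V j\<^esub>) = 2"
      "\<And>b. f j b = 2 \<Longrightarrow> F p (pair \<zero>\<^bsub>V i\<^esub> b) = 2"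
    and bound: "\<And>x y. x \<in> carrier P \<Longrightarrow> y \<in> carrier P \<Longrightarrow>
      F p (x \<oplus>\<^bsub>P\<^esub> y) powr \<sigma> + F p (x \<ominus>\<^bsub>P\<^esub> y) powr \<sigma>
        \<le> 2 powr (\<sigma> / \<alpha>) * (F p x powr \<sigma> + F p y powr \<sigma>)"
  shows "C_NJ P (d_psi I d p) \<sigma> = ereal (2 powr (\<sigma> / \<alpha> - \<sigma> + 1))"
proof -
  interpret j: abelian_group "V j" by (rule abelian[OF ij(2)])
  have v': "f j (\<ominus>\<^bsub>V j\<^esub> v) = 1" using f_uminus[OF ij(2) hom_j v(1)] v by simp
  have uu: "f i (u \<oplus>\<^bsub>V i\<^esub> u) = 2" using f_double[OF ij(1) hom_i u(1)] u by simp
  have vv: "f j (v \<oplus>\<^bsub>V j\<^esub> v) = 2" using f_double[OF ij(2) abs_imp_pos_homogeneous[OF hom_j] v(1)] v by simp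
  let ?x = "pair u v" and ?y = "pair u (\<ominus>\<^bsub>V j\<^esub> v)"
  show ?thesis
  proof (rule C_NJ_eqI[where W = P and e = "d_psi I d p" and x = ?x and y = ?y and s = s, folded F_def])
    show "?x \<in> carrier P" "?y \<in> carrier P" using u v by (auto intro: pair_closed)
    show "?x \<noteq> \<zero>\<^bsub>P\<^esub>" by (rule pair_neq_zero) (simp add: u)
    show "F p ?x = s" "F p ?y = s" using F(1) u v v' by auto
    show "F p (?x \<oplus>\<^bsub>P\<^esub> ?y) = 2 powr (1 / \<alpha>) * s"
      unfolding F_diagonal_add F(2)[OF uu] by (rule s(2))
    show "F p (?x \<ominus>\<^bsub>P\<^esub> ?y) = 2 powr (1 / \<alpha>) * s"
      unfolding F_diagonal_minus F(3)[OF vv] by (rule s(2))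
  qed (use bound s in auto)
qed

lemma C_NJ_clarkson_le_2:
  assumes pq: "1 < p" "p \<le> 2" "1 / p + 1 / q = 1" and \<sigma>: "\<sigma> \<in> {p..q}"
    and cl: "\<And>k. k \<in> I \<Longrightarrow> clarkson (V k) (f k) p q"
  shows "C_NJ P (d_psi I d (ereal p)) \<sigma> = ereal (2 powr (\<sigma> / p - \<sigma> + 1))"
proof (rule C_NJ_eq_separate)
  fix x y assume x: "x \<in> carrier P" and y: "y \<in> carrier P"
  have "A powr q + B powr q \<le> 2 * (C powr p + D powr p) powr (q / p)"
    if "A = F (ereal p) (x \<oplus>\<^bsub>P\<^esub> y)" "B = F (ereal p) (x \<ominus>\<^bsub>P\<^esub> y)"
      "C = F (ereal p) x" "D = F (ereal p) y" for A B C D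
    unfolding that F_def dist_zero_P
  proof (rule lp_norm_clarkson_le)
    fix k assume k: "k \<in> I"
    show "f k ((x \<oplus>\<^bsub>P\<^esub> y) k) powr q + f k ((x \<ominus>\<^bsub>P\<^esub> y) k) powr q
      \<le> 2 * (f k (x k) powr p + f k (y k) powr p) powr (q / p)"
      using cl[OF k] x y k unfolding clarkson_def by (auto simp: P_add P_minus carrier_P)
  \<comment> \<open>The condition \<open>p \<le> q\<close> comes from the membership of \<sigma> in
    \<open>{p..q}\<close>.\<close>
  qed (use pq \<sigma> finite_I f_nonneg in auto)
  then show "F (ereal p) (x \<oplus>\<^bsub>P\<^esub> y) powr \<sigma> + F (ereal p) (x \<ominus>\<^bsub>P\<^esub> y) powr \<sigma>
        \<le> 2 powr (\<sigma> / p) * (F (ereal p) x powr \<sigma> + F (ereal p) y powr \<sigma>)"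
    using pq \<sigma> by (intro clarkson_imp_NJ_bound) (auto simp: F_def dist_zero_P lp_norm_nonneg)
qed (use pq in auto)

text \<open>The norm exponent p is now the larger Clarkson exponent, so
  \<open>lp_norm_clarkson_ge\<close> transfers the inequality and the diagonal witnesses are
  extremal with \<alpha> = q.\<close>

lemma C_NJ_clarkson_gt_2:
  assumes pq: "2 < p" "1 / p + 1 / q = 1" and \<sigma>: "\<sigma> \<in> {q..p}"
    and cl: "\<And>k. k \<in> I \<Longrightarrow> clarkson (V k) (f k) q p"
  shows "C_NJ P (d_psi I d (ereal p)) \<sigma> = ereal (2 powr (1 - \<sigma> / p))"
proof -
  have iq: "1 / q = 1 - 1 / p" using pq by simp
  have "0 < 1 / q" unfolding iq using pq by simp
  then have q: "0 < q" by simp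
  have "C_NJ P (d_psi I d (ereal p)) \<sigma> = ereal (2 powr (\<sigma> / q - \<sigma> + 1))"
  proof (rule C_NJ_eq_diagonal)
    fix x y assume x: "x \<in> carrier P" and y: "y \<in> carrier P"
    have "A powr p + B powr p \<le> 2 * (C powr q + D powr q) powr (p / q)"
      if "A = F (ereal p) (x \<oplus>\<^bsub>P\<^esub> y)" "B = F (ereal p) (x \<ominus>\<^bsub>P\<^esub> y)"
        "C = F (ereal p) x" "D = F (ereal p) y" for A B C D
      unfolding that F_def dist_zero_P
    proof (rule lp_norm_clarkson_ge)
      fix k assume k: "k \<in> I"
      show "f k ((x \<oplus>\<^bsub>P\<^esub> y) k) powr p + f k ((x \<ominus>\<^bsub>P\<^esub> y) k) powr p
        \<le> 2 * (f k (x k) powr q + f k (y k) powr q) powr (p / q)"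
        using cl[OF k] x y k unfolding clarkson_def by (auto simp: P_add P_minus carrier_P)
    qed (use pq q \<sigma> finite_I f_nonneg in auto)
    then show "F (ereal p) (x \<oplus>\<^bsub>P\<^esub> y) powr \<sigma> + F (ereal p) (x \<ominus>\<^bsub>P\<^esub> y) powr \<sigma>
          \<le> 2 powr (\<sigma> / q) * (F (ereal p) x powr \<sigma> + F (ereal p) y powr \<sigma>)"
      using q \<sigma> by (intro clarkson_imp_NJ_bound) (auto simp: F_def dist_zero_P lp_norm_nonneg)
  next
    \<comment> \<open>This fixes s as the p-norm of a vector with two unit coordinates; the identity
      is the conjugacy of p and q.\<close>
    show "2 = 2 powr (1 / q) * 2 powr (1 / p)"
      unfolding powr_add[symmetric] using pq by (simp add: add.commute)
  qed (use pq in \<open>auto simp: F_pair f_zero ij powr_powr\<close>)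
  also have "\<sigma> / q - \<sigma> + 1 = 1 - \<sigma> / p"
  proof -
    have "\<sigma> / q = \<sigma> * (1 - 1 / p)" unfolding iq[symmetric] by simp
    then show ?thesis by (simp add: right_diff_distrib)
  qed
  finally show ?thesis .
qed

section \<open>Subadditive even lengths with p = 1 and p = \<infinity>\<close>

context
  assumes sub: "\<And>k. k \<in> I \<Longrightarrow> subadditive_on (V k) (f k)"
    and even: "\<And>k. k \<in> I \<Longrightarrow> even_on (V k) (f k)"
begin

lemma f_add_le:
  "k \<in> I \<Longrightarrow> x \<in> carrier P \<Longrightarrow> y \<in> carrier P \<Longrightarrow> f k ((x \<oplus>\<^bsub>P\<^esub> y) k) \<le> f k (x k) + f k (y k)"
  using sub[of k] by (auto simp: subadditive_on_def P_add carrier_P PiE_iff)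

lemma f_minus_le:
  assumes "k \<in> I" "x \<in> carrier P" "y \<in> carrier P"
  shows "f k ((x \<ominus>\<^bsub>P\<^esub> y) k) \<le> f k (x k) + f k (y k)"
proof -
  have "y k \<in> carrier (V k)" using assms by (auto simp: carrier_P)
  then have "f k ((\<ominus>\<^bsub>P\<^esub> y) k) = f k (y k)"
    using even[OF assms(1)] assms by (simp add: even_on_def P_uminus)
  then show ?thesis
    using f_add_le[OF assms(1,2) abelian_group.a_inv_closed[OF P_abelian assms(3)]]
    by (simp add: a_minus_def)
qed

text \<open>For p = 1 the length is the plain sum of the coordinate lengths, so coordinatewise
  triangle inequalities add up.\<close>

lemma C_NJ_subadditive_1:
  assumes "1 \<le> \<sigma>"
  shows "C_NJ P (d_psi I d 1) \<sigma> = 2"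
proof -
  have F1: "F (ereal 1) x = (\<Sum>k\<in>I. f k (x k))" for x
    using f_nonneg by (simp add: F_def dist_zero_P lp_norm_def sum_nonneg)
  have "C_NJ P (d_psi I d (ereal 1)) \<sigma> = ereal (2 powr (\<sigma> / 1 - \<sigma> + 1))"
  proof (rule C_NJ_eq_separate)
    fix x y assume "x \<in> carrier P" "y \<in> carrier P"
    then show "F (ereal 1) (x \<oplus>\<^bsub>P\<^esub> y) powr \<sigma> + F (ereal 1) (x \<ominus>\<^bsub>P\<^esub> y) powr \<sigma>
          \<le> 2 powr (\<sigma> / 1) * (F (ereal 1) x powr \<sigma> + F (ereal 1) y powr \<sigma>)"
      unfolding F1 using assms
      by (intro subadditive_imp_NJ_bound)
        (auto simp flip: sum.distrib intro!: sum_nonneg sum_mono f_add_le f_minus_le f_nonneg)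
  qed simp
  then show ?thesis by (simp add: one_ereal_def)
qed

lemma C_NJ_subadditive_infinity:
  assumes "1 \<le> \<sigma>"
  shows "C_NJ P (d_psi I d \<infinity>) \<sigma> = 2"
proof -
  have le_F: "f k (x k) \<le> F \<infinity> x" if "k \<in> I" for k x
    using that finite_I by (simp add: F_def dist_zero_P_infinity)
  \<comment> \<open>The index i witnesses that the maximum is over a nonempty set.\<close>
  have F_le: "F \<infinity> x \<le> c" if "\<And>k. k \<in> I \<Longrightarrow> f k (x k) \<le> c" for x c
    using that finite_I ij(1) unfolding F_def dist_zero_P_infinity by (subst Max_le_iff) auto
  have F_nonneg: "0 \<le> F \<infinity> x" for x
    using le_F[OF ij(1), of x] f_nonneg[OF ij(1), of "x i"] by linarith
  have "C_NJ P (d_psi I d \<infinity>) \<sigma> = ereal (2 powr (\<sigma> / 1 - \<sigma> + 1))"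
  proof (rule C_NJ_eq_diagonal)
    fix x y assume x: "x \<in> carrier P" and y: "y \<in> carrier P"
    have le: "f k (x k) + f k (y k) \<le> F \<infinity> x + F \<infinity> y" if "k \<in> I" for k
      using le_F[OF that] by (intro add_mono)
    show "F \<infinity> (x \<oplus>\<^bsub>P\<^esub> y) powr \<sigma> + F \<infinity> (x \<ominus>\<^bsub>P\<^esub> y) powr \<sigma>
          \<le> 2 powr (\<sigma> / 1) * (F \<infinity> x powr \<sigma> + F \<infinity> y powr \<sigma>)"
    proof (rule subadditive_imp_NJ_bound)
      show "F \<infinity> (x \<oplus>\<^bsub>P\<^esub> y) \<le> F \<infinity> x + F \<infinity> y"
        using order_trans[OF f_add_le[OF _ x y] le] by (rule F_le)
      show "F \<infinity> (x \<ominus>\<^bsub>P\<^esub> y) \<le> F \<infinity> x + F \<infinity> y"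
        using order_trans[OF f_minus_le[OF _ x y] le] by (rule F_le)
    qed (use assms F_nonneg in auto)
  next
    \<comment> \<open>This fixes s = 1, the maximum of two unit lengths.\<close>
    show "(0::real) < 1" by simp
  qed (auto simp: F_infinity_pair f_zero ij)
  then show ?thesis by simp
qed

end

end

theorem theorem29:
  fixes n :: nat
    and V :: "nat \<Rightarrow> (real, 'a) module"
    and d :: "nat \<Rightarrow> 'a \<Rightarrow> 'a \<Rightarrow> real"
    and f :: "nat \<Rightarrow> 'a \<Rightarrow> real"
  assumes "n \<ge> 2"
    and "\<And>k. k \<in> {1..n} \<Longrightarrow> real_vspace (V k)"
    and "\<And>k. k \<in> {1..n} \<Longrightarrow> carrier (V k) \<noteq> {\<zero>\<^bsub>V k\<^esub>}"
    and "\<And>k. k \<in> {1..n} \<Longrightarrow> Metric_space (carrier (V k)) (d k)"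
    and "\<And>k. k \<in> {1..n} \<Longrightarrow> f k = dist_zero (V k) (d k)"
    and "\<exists>i\<in>{1..n}. \<exists>j\<in>{1..n}. i \<noteq> j \<and>
           pos_homogeneous (V i) (f i) \<and> abs_homogeneous (V j) (f j) \<and>
           (\<forall>k\<in>{1..n} - {i, j}. two_homogeneous (V k) (f k))"
  shows
    "(\<forall>p q :: real. 1 < p \<and> p \<le> 2 \<and> 1 / p + 1 / q = 1 \<and>
        (\<forall>k\<in>{1..n}. clarkson (V k) (f k) p q) \<longrightarrow>
        (\<forall>\<sigma>\<in>{p..q}. C_NJ (prod_vspace {1..n} V) (d_psi {1..n} d (ereal p)) \<sigma>
                      = ereal (2 powr (\<sigma> / p - \<sigma> + 1)))) \<and>
     (\<forall>p q :: real. 2 < p \<and> 1 / p + 1 / q = 1 \<and>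
        (\<forall>k\<in>{1..n}. clarkson (V k) (f k) q p) \<longrightarrow>
        (\<forall>\<sigma>\<in>{q..p}. C_NJ (prod_vspace {1..n} V) (d_psi {1..n} d (ereal p)) \<sigma>
                      = ereal (2 powr (1 - \<sigma> / p)))) \<and>
     ((\<forall>k\<in>{1..n}. subadditive_on (V k) (f k) \<and> even_on (V k) (f k)) \<longrightarrow>
        (\<forall>\<sigma>\<ge>1. C_NJ (prod_vspace {1..n} V) (d_psi {1..n} d 1) \<sigma> = 2 \<and>
                C_NJ (prod_vspace {1..n} V) (d_psi {1..n} d \<infinity>) \<sigma> = 2))"
proof -
  obtain i j where ij: "i \<in> {1..n}" "j \<in> {1..n}" "i \<noteq> j"
    and hom: "pos_homogeneous (V i) (f i)" "abs_homogeneous (V j) (f j)"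
    using assms(6) by blast
  interpret fam: metric_vspace_family "{1..n}" V d
    using assms(1-4) by (intro metric_vspace_family.intro) auto
  \<comment> \<open>The given \<open>f\<close> is specified on \<open>{1..n}\<close> only, so the
    rewriting is guarded by membership.\<close>
  have f: "f k = fam.f k" if "k \<in> {1..n}" for k
    using assms(5)[OF that] by (simp add: fam.f_def)
  have hom_i: "pos_homogeneous (V i) (fam.f i)" and hom_j: "abs_homogeneous (V j) (fam.f j)"
    using hom f ij by simp_all
  \<comment> \<open>Nontriviality of the two distinguished factors supplies the unit vectors that
    \<open>two_factors\<close> takes as parameters.\<close>
  obtain u where u: "u \<in> carrier (V i)" "fam.f i u = 1"
    using fam.ex_unit[OF ij(1) hom_i assms(3)[OF ij(1)]] .
  obtain v where v: "v \<in> carrier (V j)" "fam.f j v = 1"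
    using fam.ex_unit[OF ij(2) abs_imp_pos_homogeneous[OF hom_j] assms(3)[OF ij(2)]] .
  interpret two_factors "{1..n}" V d i j u v
    using ij hom_i hom_j u v
    by (intro two_factors.intro two_factors_axioms.intro fam.metric_vspace_family_axioms)
  show ?thesis
  proof (intro conjI allI impI ballI, goal_cases)
    case (1 p q \<sigma>)
    then show ?case using f by (intro C_NJ_clarkson_le_2) auto
  next
    case (2 p q \<sigma>)
    then show ?case using f by (intro C_NJ_clarkson_gt_2) auto
  next
    case (3 \<sigma>)
    then show ?case using f by (intro C_NJ_subadditive_1) auto
  next
    case (4 \<sigma>)
    then show ?case using f by (intro C_NJ_subadditive_infinity) auto
  qed
qed

end
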